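(* Let the number of cache states $\Lambda$ and the normalized cache size $\gamma$ be fixed. For any average SNR $\rho>0$, the ACC scheme guarantees $$\lim_{B\to\infty}\frac{\bar R^{(\mathrm{ACC})}}{\bar R^{(\mathrm{TDM})}}=\Lambda\gamma+1,$$ and thus its effective coded-caching gain matches, in the limit of many users per cache, the nominal gain $\Lambda\gamma+1$ for any value of the SNR.
   Context: Setting: $K=\Lambda B$ users are divided into $\Lambda$ groups of $B$ users each (users in a group share the same cache content). $\gamma\in[0,1]$ is the normalized cache size, $\Lambda\gamma$ is an integer with $\Lambda\gamma+1\le\Lambda$, and $\mathcal G\subseteq\{1,\dots,\Lambda\}$ is a set of $G=|\mathcal G|=\Lambda\gamma+1$ groups served simultaneously. $\mathrm{SNR}_{g,b}$, the instantaneous SNR of user $b$ of group $g$, are i.i.d. exponential random variables with mean $\rho>0$ (density $\frac1\rho e^{-x/\rho}$, $x\ge0$). The average rate of the ACC (Aggregated Coded Caching) scheme is $$\bar R^{(\mathrm{ACC})}=\frac{G}{\ln2}\,\mathbb E\Big\{\min_{g\in\mathcal G}\frac1B\sum_{b=1}^B\ln(1+\mathrm{SNR}_{g,b})\Big\}.$$ The average rate of uncoded time division multiplexing (TDM) is $\bar R^{(\mathrm{TDM})}=\frac1{\ln2}\mathbb E\{\ln(1+\mathrm{SNR}_{g,b})\}$. The effective gain of the ACC scheme is the ratio $\bar R^{(\mathrm{ACC})}/\bar R^{(\mathrm{TDM})}$. *)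

theory Defs
  imports "HOL-Probability.Probability"
begin

text \<open>Users are pairs \<open>(g, b)\<close> with group \<open>g \<in> {1..\<Lambda>}\<close> and position \<open>b \<in> {1..B}\<close>.  The rate
  \<open>1 / \<rho>\<close> of the exponential density corresponds to mean SNR \<open>\<rho>\<close>.\<close>

definition iid_exponential_snr ::
    "'w measure \<Rightarrow> nat \<Rightarrow> nat \<Rightarrow> real \<Rightarrow> (nat \<Rightarrow> nat \<Rightarrow> 'w \<Rightarrow> real) \<Rightarrow> bool" where
  "iid_exponential_snr M \<Lambda> B \<rho> SNR \<longleftrightarrow>
     prob_space M \<and>
     prob_space.indep_vars M (\<lambda>_. borel) (\<lambda>(g, b). SNR g b) ({1..\<Lambda>} \<times> {1..B}) \<and>
     (\<forall>g\<in>{1..\<Lambda>}. \<forall>b\<in>{1..B}.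
        distributed M lborel (SNR g b) (\<lambda>x. ennreal (exponential_density (1 / \<rho>) x)))"

definition acc_rate ::
    "'w measure \<Rightarrow> nat set \<Rightarrow> nat \<Rightarrow> (nat \<Rightarrow> nat \<Rightarrow> 'w \<Rightarrow> real) \<Rightarrow> real" where
  "acc_rate M \<G> B SNR =
     real (card \<G>) / ln 2 *
     prob_space.expectation M
       (\<lambda>\<omega>. MIN g\<in>\<G>. 1 / real B * (\<Sum>b = 1..B. ln (1 + SNR g b \<omega>)))"

definition tdm_rate :: "'w measure \<Rightarrow> ('w \<Rightarrow> real) \<Rightarrow> real" where
  "tdm_rate M X = 1 / ln 2 * prob_space.expectation M (\<lambda>\<omega>. ln (1 + X \<omega>))"

end

theory Submission
  imports Defs "HOL-Real_Asymp.Real_Asymp"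
begin

text \<open>
  The variables \<open>ln (1 + SNR g b)\<close> are i.i.d. with a positive mean \<open>m\<close> and a second moment of at most
  \<open>2 * \<rho>\<^sup>2\<close>, because \<open>0 \<le> ln (1 + x) \<le> x\<close>.  Hence each of the \<open>card \<G>\<close> sample means has
  mean absolute deviation \<open>O(1 / sqrt B)\<close> from \<open>m\<close>.  The minimum deviates from \<open>m\<close> by at most the
  sum of these deviations, so its expectation tends to \<open>m\<close>.
\<close>

section \<open>Mean deviation of sample means of independent variables\<close>

text \<open>Independence factors the mean of the cross term \<open>X i * ?S\<close> into a product
  of means, which vanishes because the variables are centred. Both claims go through one induction,
  since additivity of the expectation in each step uses the integrability just obtained.\<close>

lemma (in prob_space) indep_vars_sum_square:
  fixes X :: "'i \<Rightarrow> 'a \<Rightarrow> real"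
  assumes "finite I" and "indep_vars (\<lambda>_. borel) X I"
    and "\<And>i. i \<in> I \<Longrightarrow> integrable M (\<lambda>\<omega>. (X i \<omega>)\<^sup>2)"
    and "\<And>i. i \<in> I \<Longrightarrow> expectation (X i) = 0"
  shows integrable_indep_vars_sum_square: "integrable M (\<lambda>\<omega>. (\<Sum>i\<in>I. X i \<omega>)\<^sup>2)" (is "?int I")
    and expectation_indep_vars_sum_square:
      "expectation (\<lambda>\<omega>. (\<Sum>i\<in>I. X i \<omega>)\<^sup>2) = (\<Sum>i\<in>I. expectation (\<lambda>\<omega>. (X i \<omega>)\<^sup>2))" (is "?eq I")
proof -
  have "?int I \<and> ?eq I"
    using assms
  proof (induction I rule: finite_induct)
    case empty
    then show ?case by simp
  next
    case (insert i I)
    let ?S = "\<lambda>\<omega>. \<Sum>j\<in>I. X j \<omega>"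
    have rv: "random_variable borel (X j)" if "j \<in> insert i I" for j
      using insert.prems(1) that by (auto simp: indep_vars_def)
    have int: "integrable M (X j)" if "j \<in> insert i I" for j
      using square_integrable_imp_integrable[OF rv insert.prems(2)] that by blast
    have "indep_vars (\<lambda>_. borel) X I"
      using insert.prems(1) by (rule indep_vars_subset) blast
    with insert have IH: "integrable M (\<lambda>\<omega>. (?S \<omega>)\<^sup>2)"
      "expectation (\<lambda>\<omega>. (?S \<omega>)\<^sup>2) = (\<Sum>j\<in>I. expectation (\<lambda>\<omega>. (X j \<omega>)\<^sup>2))"
      by auto
    have indep: "indep_var borel (X i) borel ?S"
      using insert.hyps insert.prems(1) by (intro indep_vars_sum) auto
    have intS: "integrable M ?S"
      using int by auto
    have prod: "integrable M (\<lambda>\<omega>. X i \<omega> * ?S \<omega>)"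
      "expectation (\<lambda>\<omega>. X i \<omega> * ?S \<omega>) = 0"
      using indep_var_integrable[OF indep int intS] indep_var_lebesgue_integral[OF indep int intS]
        insert.prems(3) by auto
    have expand: "(\<Sum>j\<in>insert i I. X j \<omega>)\<^sup>2 = (X i \<omega>)\<^sup>2 + (?S \<omega>)\<^sup>2 + 2 * (X i \<omega> * ?S \<omega>)" for \<omega>
      using insert.hyps by (simp add: power2_sum)
    have sq: "integrable M (\<lambda>\<omega>. (X i \<omega>)\<^sup>2)"
      using insert.prems(2) by blast
    show ?case
      unfolding expand using IH prod sq insert.hyps by simp
  qed
  then show "?int I" "?eq I" by auto
qed

text \<open>The centred sum has second moment at most \<open>n * v\<close>, with \<open>n\<close>
  the number of variables, so the sample mean is off by order \<open>1 / sqrt n\<close>. Passing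
  from the second moment to the absolute moment by AM-GM rather than Cauchy-Schwarz costs only a
  constant: \<open>(1 + v) / 2\<close> in place of \<open>sqrt v\<close>.\<close>

lemma (in prob_space) sample_mean_deviation:
  fixes X :: "'i \<Rightarrow> 'a \<Rightarrow> real"
  assumes fin: "finite I" and ne: "I \<noteq> {}" and indep: "indep_vars (\<lambda>_. borel) X I"
    and sq: "\<And>i. i \<in> I \<Longrightarrow> integrable M (\<lambda>\<omega>. (X i \<omega>)\<^sup>2)"
    and mean: "\<And>i. i \<in> I \<Longrightarrow> expectation (X i) = m"
    and bound: "\<And>i. i \<in> I \<Longrightarrow> expectation (\<lambda>\<omega>. (X i \<omega>)\<^sup>2) \<le> v"
  shows "expectation (\<lambda>\<omega>. \<bar>1 / real (card I) * (\<Sum>i\<in>I. X i \<omega>) - m\<bar>)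
           \<le> (1 + v) / (2 * sqrt (real (card I)))"
proof -
  let ?n = "real (card I)"
  let ?s = "sqrt ?n"
  have n: "?n > 0" using fin ne by (simp add: card_gt_0_iff)
  then have s: "?s > 0" "?s * ?s = ?n" by auto
  define Y where "Y i \<omega> = X i \<omega> - m" for i \<omega>
  have rv: "random_variable borel (X i)" if "i \<in> I" for i
    using indep that by (auto simp: indep_vars_def)
  have int: "integrable M (X i)" if "i \<in> I" for i
    using square_integrable_imp_integrable[OF rv sq] that by blast
  have indepY: "indep_vars (\<lambda>_. borel) Y I"
    using indep_vars_compose2[OF indep, of "\<lambda>_ x. x - m" "\<lambda>_. borel"]
    unfolding Y_def by simp
  have sqY: "integrable M (\<lambda>\<omega>. (Y i \<omega>)\<^sup>2)" if "i \<in> I" for i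
    using sq[OF that] int[OF that] by (simp add: Y_def power2_diff)
  have meanY: "expectation (Y i) = 0" if "i \<in> I" for i
    using mean[OF that] int[OF that] by (simp add: Y_def[abs_def] prob_space)
  have varY: "expectation (\<lambda>\<omega>. (Y i \<omega>)\<^sup>2) \<le> v" if "i \<in> I" for i
  proof -
    \<comment> \<open>Centring lowers the second moment by the square of the mean, so the bound
      \<open>v\<close> carries over to the variance.\<close>
    have "expectation (\<lambda>\<omega>. (Y i \<omega>)\<^sup>2) = expectation (\<lambda>\<omega>. (X i \<omega>)\<^sup>2) - m\<^sup>2"
      using variance_eq[OF int sq, OF that that] mean[OF that] by (simp add: Y_def)
    then show ?thesis using bound[OF that] zero_le_power2[of m] by linarith
  qed
  define Z where "Z \<omega> = (\<Sum>i\<in>I. Y i \<omega>)" for \<omega>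
  have sqZ: "integrable M (\<lambda>\<omega>. (Z \<omega>)\<^sup>2)"
    unfolding Z_def using integrable_indep_vars_sum_square[OF fin indepY sqY meanY] .
  have "expectation (\<lambda>\<omega>. (Z \<omega>)\<^sup>2) = (\<Sum>i\<in>I. expectation (\<lambda>\<omega>. (Y i \<omega>)\<^sup>2))"
    unfolding Z_def using expectation_indep_vars_sum_square[OF fin indepY sqY meanY] .
  also have "\<dots> \<le> ?n * v"
    using varY by (rule sum_bounded_above)
  finally have varZ: "expectation (\<lambda>\<omega>. (Z \<omega>)\<^sup>2) \<le> ?n * v" .
  have dev: "1 / ?n * (\<Sum>i\<in>I. X i \<omega>) - m = Z \<omega> / ?n" for \<omega>
    using n by (simp add: Z_def Y_def sum_subtractf field_simps)
  \<comment> \<open>AM-GM for \<open>1\<close> and \<open>\<bar>Z\<bar> / sqrt n\<close>\<close>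
  have amgm: "\<bar>z / ?n\<bar> \<le> (1 + z\<^sup>2 / ?n) / (2 * ?s)" for z
  proof -
    have "0 \<le> (?s - \<bar>z\<bar>)\<^sup>2" by simp
    then have "2 * (?s * \<bar>z\<bar>) \<le> ?n + z\<^sup>2"
      by (simp add: power2_diff mult.assoc)
    then have "2 * (?s * \<bar>z\<bar>) / (2 * ?s * ?n) \<le> (?n + z\<^sup>2) / (2 * ?s * ?n)"
      using s n by (intro divide_right_mono) auto
    then show ?thesis using s n by (simp add: field_simps)
  qed
  have intZ: "integrable M Z"
    unfolding Z_def Y_def using int by auto
  have "expectation (\<lambda>\<omega>. \<bar>1 / ?n * (\<Sum>i\<in>I. X i \<omega>) - m\<bar>)
      \<le> expectation (\<lambda>\<omega>. (1 + (Z \<omega>)\<^sup>2 / ?n) / (2 * ?s))"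
    unfolding dev using intZ sqZ amgm by (intro integral_mono) auto
  also have "\<dots> = (1 + expectation (\<lambda>\<omega>. (Z \<omega>)\<^sup>2) / ?n) / (2 * ?s)"
    using sqZ by (simp add: prob_space)
  also have "\<dots> \<le> (1 + v) / (2 * ?s)"
    using varZ n s
    by (intro divide_right_mono add_left_mono) (auto simp: field_simps)
  finally show ?thesis .
qed

section \<open>Deviation of a minimum\<close>

text \<open>A minimum over a finite nonempty set is attained, so its deviation is itself one of the
  nonnegative summands.\<close>

lemma abs_Min_diff_le_sum:
  fixes f :: "'i \<Rightarrow> 'b::linordered_idom"
  assumes "finite A" and "A \<noteq> {}"
  shows "\<bar>(MIN i\<in>A. f i) - m\<bar> \<le> (\<Sum>i\<in>A. \<bar>f i - m\<bar>)"
proof -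
  have "(MIN i\<in>A. f i) \<in> f ` A"
    using assms by (intro Min_in) auto
  then obtain i where "i \<in> A" "(MIN i\<in>A. f i) = f i" by auto
  then show ?thesis
    using member_le_sum[of i A "\<lambda>i. \<bar>f i - m\<bar>"] assms by simp
qed

text \<open>Total mass one lets the constant \<open>m\<close> move under the expectation; the
  pointwise bound for the minimum is then integrated.\<close>

lemma (in prob_space) expectation_Min_deviation:
  fixes Z :: "'i \<Rightarrow> 'a \<Rightarrow> real"
  assumes "finite A" and "A \<noteq> {}" and int: "\<And>i. i \<in> A \<Longrightarrow> integrable M (Z i)"
  shows "\<bar>expectation (\<lambda>\<omega>. MIN i\<in>A. Z i \<omega>) - m\<bar> \<le> (\<Sum>i\<in>A. expectation (\<lambda>\<omega>. \<bar>Z i \<omega> - m\<bar>))"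
proof -
  have intMin: "integrable M (\<lambda>\<omega>. MIN i\<in>A. Z i \<omega>)"
    using assms by (intro integrable_MIN) auto
  then have "\<bar>expectation (\<lambda>\<omega>. MIN i\<in>A. Z i \<omega>) - m\<bar> = \<bar>expectation (\<lambda>\<omega>. (MIN i\<in>A. Z i \<omega>) - m)\<bar>"
    by (simp add: prob_space)
  also have "\<dots> \<le> expectation (\<lambda>\<omega>. \<bar>(MIN i\<in>A. Z i \<omega>) - m\<bar>)"
    by (rule integral_abs_bound)
  also have "\<dots> \<le> expectation (\<lambda>\<omega>. \<Sum>i\<in>A. \<bar>Z i \<omega> - m\<bar>)"
    using intMin int abs_Min_diff_le_sum[OF assms(1,2)] by (intro integral_mono) auto
  also have "\<dots> = (\<Sum>i\<in>A. expectation (\<lambda>\<omega>. \<bar>Z i \<omega> - m\<bar>))"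
    using int by (intro Bochner_Integration.integral_sum) auto
  finally show ?thesis .
qed

section \<open>The logarithm of an exponential variable\<close>

text \<open>Written as a Lebesgue integral against the density, so that the value depends on the
  rate alone. The probability space changes with \<open>B\<close>, and the limit argument needs one
  constant for all of them.\<close>

definition exponential_mean_log :: "real \<Rightarrow> real" where
  "exponential_mean_log l = (\<integral>x. exponential_density l x * ln (1 + x) \<partial>lborel)"

context prob_space
begin

context
  fixes X :: "'a \<Rightarrow> real" and l :: real
  assumes l: "0 < l" and D: "distributed M lborel X (exponential_density l)"
begin

private lemma exponential_measurable [measurable]: "X \<in> borel_measurable M"
  using distributed_measurable[OF D] by simp

private lemma exponential_AE_pos: "AE \<omega> in M. 0 \<le> X \<omega>"
proof -
  \<comment> \<open>The density vanishes on the negative half-line, which confines \<open>X\<close>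
    almost surely to the range where \<open>ln (1 + x)\<close> is nonnegative and at most
    \<open>x\<close>.\<close>
  have "AE x in lborel. 0 < ennreal (exponential_density l x) \<longrightarrow> 0 \<le> x"
    by (auto simp: exponential_density_def)
  then show ?thesis
    using distributed_AE2[OF D, of "\<lambda>x. 0 \<le> x"] by simp
qed

private lemma log_exponential_AE_bounds: "AE \<omega> in M. 0 \<le> ln (1 + X \<omega>) \<and> ln (1 + X \<omega>) \<le> X \<omega>"
  using exponential_AE_pos by eventually_elim (auto simp: ln_add_one_self_le_self)

lemma log_exponential_square_integrable: "integrable M (\<lambda>\<omega>. (ln (1 + X \<omega>))\<^sup>2)"
proof (rule Bochner_Integration.integrable_bound)
  show "integrable M (\<lambda>\<omega>. (X \<omega>)\<^sup>2)"
    using erlang_ith_moment_integrable[OF l D] .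
  show "AE \<omega> in M. norm ((ln (1 + X \<omega>))\<^sup>2) \<le> norm ((X \<omega>)\<^sup>2)"
    using log_exponential_AE_bounds by eventually_elim (auto intro: power_mono)
qed simp

lemma log_exponential_integrable: "integrable M (\<lambda>\<omega>. ln (1 + X \<omega>))"
  using log_exponential_square_integrable by (rule square_integrable_imp_integrable[rotated]) simp

lemma log_exponential_second_moment_le: "expectation (\<lambda>\<omega>. (ln (1 + X \<omega>))\<^sup>2) \<le> 2 / l\<^sup>2"
proof -
  have "expectation (\<lambda>\<omega>. (ln (1 + X \<omega>))\<^sup>2) \<le> expectation (\<lambda>\<omega>. (X \<omega>)\<^sup>2)"
    using log_exponential_AE_bounds
    by (intro integral_mono_AE log_exponential_square_integrable erlang_ith_moment_integrable[OF l D])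
      (auto intro: power_mono)
  also have "\<dots> = 2 / l\<^sup>2"
    using erlang_ith_moment[OF l D, of 2] by (simp add: fact_numeral)
  finally show ?thesis .
qed

lemma expectation_log_exponential: "expectation (\<lambda>\<omega>. ln (1 + X \<omega>)) = exponential_mean_log l"
  unfolding exponential_mean_log_def
  using distributed_integral[OF D, of "\<lambda>x. ln (1 + x)"] l by simp

text \<open>A zero mean would force the nonnegative variable \<open>ln (1 + X)\<close>, hence
  \<open>X\<close>, to vanish almost surely, against the mean \<open>1 / l\<close> of
  \<open>X\<close>.\<close>

lemma exponential_mean_log_pos: "exponential_mean_log l > 0"
proof -
  have nonneg: "AE \<omega> in M. 0 \<le> ln (1 + X \<omega>)"
    using log_exponential_AE_bounds by auto
  have "expectation (\<lambda>\<omega>. ln (1 + X \<omega>)) \<noteq> 0"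
  proof
    assume "expectation (\<lambda>\<omega>. ln (1 + X \<omega>)) = 0"
    then have "AE \<omega> in M. ln (1 + X \<omega>) = 0"
      using integral_nonneg_eq_0_iff_AE[OF log_exponential_integrable nonneg] by simp
    with exponential_AE_pos have "AE \<omega> in M. X \<omega> = 0"
      by eventually_elim (auto simp: ln_eq_zero_iff)
    then have "expectation X = 0"
      by (rule integral_eq_zero_AE)
    then show False
      using exponential_distributed_expectation[OF l D] l by simp
  qed
  then show ?thesis
    using integral_nonneg_AE[OF nonneg] unfolding expectation_log_exponential by simp
qed

end

end

section \<open>The ACC rate and its limit\<close>

text \<open>An explicit bound that does not mention the probability space, so it can be applied to a
  different space for each \<open>B\<close>.\<close>

lemma iid_exponential_snr_Min_deviation:
  assumes iid: "iid_exponential_snr M \<Lambda> B \<rho> SNR" and "\<rho> > 0" and "B \<ge> 1"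
    and sub: "\<G> \<subseteq> {1..\<Lambda>}" and "\<G> \<noteq> {}"
  shows "\<bar>prob_space.expectation M (\<lambda>\<omega>. MIN g\<in>\<G>. 1 / real B * (\<Sum>b = 1..B. ln (1 + SNR g b \<omega>)))
           - exponential_mean_log (1 / \<rho>)\<bar>
         \<le> real (card \<G>) * ((1 + 2 * \<rho>\<^sup>2) / (2 * sqrt (real B)))"
proof -
  interpret prob_space M
    using iid by (simp add: iid_exponential_snr_def)
  let ?m = "exponential_mean_log (1 / \<rho>)"
  let ?Y = "\<lambda>p \<omega>. ln (1 + (case p of (g, b) \<Rightarrow> SNR g b) \<omega>)"
  let ?Z = "\<lambda>g \<omega>. 1 / real B * (\<Sum>b = 1..B. ln (1 + SNR g b \<omega>))"
  have l: "0 < 1 / \<rho>" using \<open>\<rho> > 0\<close> by simp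
  have fin: "finite \<G>" using sub by (rule finite_subset) simp
  have D: "distributed M lborel (SNR g b) (exponential_density (1 / \<rho>))"
    if "g \<in> {1..\<Lambda>}" "b \<in> {1..B}" for g b
    using iid that by (simp add: iid_exponential_snr_def)
  have indep: "indep_vars (\<lambda>_. borel) ?Y ({1..\<Lambda>} \<times> {1..B})"
    using iid unfolding iid_exponential_snr_def
    by (intro indep_vars_compose2[where Y = "\<lambda>_ x. ln (1 + x)" and M' = "\<lambda>_. borel"]) auto
  have int: "integrable M (?Z g)" if "g \<in> \<G>" for g
    using that sub
    by (intro integrable_mult_right Bochner_Integration.integrable_sum
        log_exponential_integrable[OF l D]) auto
  have dev: "expectation (\<lambda>\<omega>. \<bar>?Z g \<omega> - ?m\<bar>) \<le> (1 + 2 * \<rho>\<^sup>2) / (2 * sqrt (real B))"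
    if "g \<in> \<G>" for g
  proof -
    have g: "g \<in> {1..\<Lambda>}" using that sub by auto
    \<comment> \<open>The users of one group form a row of the index set of pairs. Independence
      restricts to this row, and the sum over it is reindexed by the position \<open>b\<close>. The
      second-moment bound \<open>2 / l\<^sup>2\<close> at rate \<open>l = 1 / \<rho>\<close> is the
      \<open>2 * \<rho>\<^sup>2\<close> of the claim.\<close>
    let ?I = "{g} \<times> {1..B}"
    have "expectation (\<lambda>\<omega>. \<bar>1 / real (card ?I) * (\<Sum>p\<in>?I. ?Y p \<omega>) - ?m\<bar>)
        \<le> (1 + 2 / (1 / \<rho>)\<^sup>2) / (2 * sqrt (real (card ?I)))"
    proof (rule sample_mean_deviation)
      show "indep_vars (\<lambda>_. borel) ?Y ?I"
        using indep by (rule indep_vars_subset) (use g in auto)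
    qed (use \<open>B \<ge> 1\<close> in \<open>auto intro!: log_exponential_square_integrable[OF l D]
        expectation_log_exponential[OF l D] log_exponential_second_moment_le[OF l D] g\<close>)
    moreover have "(\<Sum>p\<in>?I. ?Y p \<omega>) = (\<Sum>b = 1..B. ln (1 + SNR g b \<omega>))" for \<omega>
      by (rule sum.reindex_bij_witness[of _ "\<lambda>b. (g, b)" snd]) auto
    ultimately show ?thesis
      by (simp add: power_divide card_cartesian_product)
  qed
  have "\<bar>expectation (\<lambda>\<omega>. MIN g\<in>\<G>. ?Z g \<omega>) - ?m\<bar> \<le> (\<Sum>g\<in>\<G>. expectation (\<lambda>\<omega>. \<bar>?Z g \<omega> - ?m\<bar>))"
    using fin \<open>\<G> \<noteq> {}\<close> int by (rule expectation_Min_deviation)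
  also have "\<dots> \<le> real (card \<G>) * ((1 + 2 * \<rho>\<^sup>2) / (2 * sqrt (real B)))"
    using dev by (rule sum_bounded_above)
  finally show ?thesis .
qed

theorem lemma4:
  fixes \<Lambda> :: nat and \<gamma> \<rho> :: real and \<G> :: "nat set"
    and M :: "nat \<Rightarrow> 'w measure"
    and SNR :: "nat \<Rightarrow> nat \<Rightarrow> nat \<Rightarrow> 'w \<Rightarrow> real"
    and g b :: nat
  assumes "0 \<le> \<gamma>" and "\<gamma> \<le> 1"
    and "real \<Lambda> * \<gamma> \<in> \<int>" and "real \<Lambda> * \<gamma> + 1 \<le> real \<Lambda>"
    and "\<G> \<subseteq> {1..\<Lambda>}" and "real (card \<G>) = real \<Lambda> * \<gamma> + 1"
    and "\<rho> > 0"
    and "\<And>B. B \<ge> 1 \<Longrightarrow> iid_exponential_snr (M B) \<Lambda> B \<rho> (SNR B)"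
    and "g \<in> {1..\<Lambda>}" and "b \<ge> 1"
  shows "(\<lambda>B. acc_rate (M B) \<G> B (SNR B) / tdm_rate (M B) (SNR B g b))
           \<longlonglongrightarrow> real \<Lambda> * \<gamma> + 1"
proof -
  let ?m = "exponential_mean_log (1 / \<rho>)"
  define e where "e B = prob_space.expectation (M B)
    (\<lambda>\<omega>. MIN g\<in>\<G>. 1 / real B * (\<Sum>b = 1..B. ln (1 + SNR B g b \<omega>)))" for B
  have l: "0 < 1 / \<rho>" using \<open>\<rho> > 0\<close> by simp
  \<comment> \<open>The cardinality is at least 1 because \<open>\<Lambda> * \<gamma>\<close> is
    nonnegative; this makes the minimum over \<open>\<G>\<close> meaningful.\<close>
  have ne: "\<G> \<noteq> {}"
    using assms(6) mult_nonneg_nonneg[OF of_nat_0_le_iff assms(1), of \<Lambda>] by auto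
  \<comment> \<open>User \<open>b\<close> of group \<open>g\<close> is among the modelled users only
    once \<open>B \<ge> b\<close>. From there on the TDM rate is constant in
    \<open>B\<close>.\<close>
  have tdm: "tdm_rate (M B) (SNR B g b) = ?m / ln 2" and m: "?m > 0" if "B \<ge> b" for B
  proof -
    have iid: "iid_exponential_snr (M B) \<Lambda> B \<rho> (SNR B)"
      using assms(8,10) that by simp
    then interpret prob_space "M B" by (simp add: iid_exponential_snr_def)
    have D: "distributed (M B) lborel (SNR B g b) (exponential_density (1 / \<rho>))"
      using iid assms(9,10) that by (simp add: iid_exponential_snr_def)
    show "tdm_rate (M B) (SNR B g b) = ?m / ln 2"
      by (simp add: tdm_rate_def expectation_log_exponential[OF l D])
    show "?m > 0"
      by (rule exponential_mean_log_pos[OF l D])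
  qed
  have "(\<lambda>B. real (card \<G>) * ((1 + 2 * \<rho>\<^sup>2) / (2 * sqrt (real B)))) \<longlonglongrightarrow> 0"
    by real_asymp
  moreover have "\<forall>\<^sub>F B in sequentially.
      norm (e B - ?m) \<le> real (card \<G>) * ((1 + 2 * \<rho>\<^sup>2) / (2 * sqrt (real B)))"
    using eventually_ge_at_top[of 1]
  proof eventually_elim
    case (elim B)
    then show ?case
      using iid_exponential_snr_Min_deviation[OF assms(8) assms(7) elim assms(5) ne]
      by (simp add: e_def)
  qed
  ultimately have "(\<lambda>B. e B - ?m) \<longlonglongrightarrow> 0"
    by (rule Lim_null_comparison[rotated])
  then have "e \<longlonglongrightarrow> ?m"
    by (simp add: LIM_zero_iff)
  \<comment> \<open>The system with \<open>B = b\<close> serves as the witness for positivity of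
    \<open>?m\<close>, which permits the division.\<close>
  then have "(\<lambda>B. real (card \<G>) * (e B / ?m)) \<longlonglongrightarrow> real (card \<G>) * (?m / ?m)"
    using m[OF order_refl] by (intro tendsto_intros) auto
  then have "(\<lambda>B. real (card \<G>) * (e B / ?m)) \<longlonglongrightarrow> real \<Lambda> * \<gamma> + 1"
    using m[OF order_refl] assms(6) by simp
  \<comment> \<open>The factors \<open>1 / ln 2\<close> of the two rates cancel.\<close>
  moreover have "\<forall>\<^sub>F B in sequentially.
      real (card \<G>) * (e B / ?m) = acc_rate (M B) \<G> B (SNR B) / tdm_rate (M B) (SNR B g b)"
    using eventually_ge_at_top[of b]
    by eventually_elim (simp add: acc_rate_def tdm e_def)
  ultimately show ?thesis
    by (rule Lim_transform_eventually)
qed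

end
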